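(* Let $\nu$ be a compactly supported Borel probability measure on $\mathbb{R}^d$ and let $r\in\mathbb{R}$ with $r<-\dim_\infty(\nu)$. Then $\mathfrak{e}_{n,r}(\nu)=0$ for all $n\in\mathbb{N}$ and, in particular, $D_r(\nu)=0$. Furthermore, if $\nu$ has a (non-trivial) absolutely continuous part with respect to the Lebesgue measure, then $\mathfrak{e}_{n,-d}(\nu)=0$ for all $n\in\mathbb{N}$.
   Context: $\mathbb{R}^d$ is equipped with a fixed norm $\|\cdot\|$; $B_s(x)$ is the ball of radius $s$ centred at $x$. For $A\subset\mathbb{R}^d$ finite and non-empty, $d(x,A)=\min_{y\in A}\|x-y\|$. For $n\in\mathbb{N}$, $\mathcal{A}_n=\{A\subset\mathbb{R}^d: 1\le \operatorname{card}(A)\le n\}$. For $r<0$ the $n$-th quantization error of order $r$ is $$\mathfrak{e}_{n,r}(\nu)=\inf_{A\in\mathcal{A}_n}\Big(\int d(x,A)^r\,d\nu(x)\Big)^{1/r},$$ with the conventions $0^r=+\infty$ and $(+\infty)^{1/r}=0$ for $r<0$. The upper and lower quantization dimensions of order $r$ are $$\overline{D}_r(\nu)=\limsup_{n\to\infty}\frac{\log n}{-\log \mathfrak{e}_{n,r}(\nu)},\qquad \underline{D}_r(\nu)=\liminf_{n\to\infty}\frac{\log n}{-\log \mathfrak{e}_{n,r}(\nu)},$$ with the convention $1/\log 0=0$ (so the dimension is $0$ if $\mathfrak{e}_{n,r}(\nu)=0$ for all large $n$). If they coincide, the common value is denoted $D_r(\nu)$. The $\infty$-dimension of $\nu$ is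 $$\dim_\infty(\nu)=\liminf_{s\to 0}\frac{\sup_{x\in\mathbb{R}^d}\log\nu(B_s(x))}{\log s}.$$ *)

theory Defs
  imports "HOL-Probability.Probability"
begin

(* The library's norm on a Euclidean space is the Euclidean one; the results concern an
   arbitrary norm N, which is therefore carried as a parameter. *)
definition is_norm :: "('a::euclidean_space \<Rightarrow> real) \<Rightarrow> bool" where
  "is_norm N \<longleftrightarrow>
     (\<forall>x. N x \<ge> 0) \<and>
     (\<forall>x. N x = 0 \<longleftrightarrow> x = 0) \<and>
     (\<forall>c x. N (c *\<^sub>R x) = \<bar>c\<bar> * N x) \<and>
     (\<forall>x y. N (x + y) \<le> N x + N y)"

definition nball :: "('a::euclidean_space \<Rightarrow> real) \<Rightarrow> 'a \<Rightarrow> real \<Rightarrow> 'a set" where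
  "nball N x s = {y. N (y - x) < s}"

definition dist_to :: "('a::euclidean_space \<Rightarrow> real) \<Rightarrow> 'a \<Rightarrow> 'a set \<Rightarrow> real" where
  "dist_to N x A = Min ((\<lambda>y. N (x - y)) ` A)"

(* Only meant for negative exponents r. *)
definition neg_powr :: "ennreal \<Rightarrow> real \<Rightarrow> ennreal" where
  "neg_powr x r =
     (if x = 0 then \<infinity> else if x = \<infinity> then 0 else ennreal (enn2real x powr r))"

(* The real function ln satisfies ln 0 = 0, so the value at 0 has to be set separately. *)
definition elog :: "ennreal \<Rightarrow> ereal" where
  "elog x = (if x = 0 then -\<infinity> else if x = \<infinity> then \<infinity> else ereal (ln (enn2real x)))"

definition codebooks :: "nat \<Rightarrow> 'a set set" where
  "codebooks n = {A. finite A \<and> 1 \<le> card A \<and> card A \<le> n}"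

(* Only meant for n \<ge> 1 and r < 0. *)
definition quant_error ::
    "('a::euclidean_space \<Rightarrow> real) \<Rightarrow> nat \<Rightarrow> real \<Rightarrow> 'a measure \<Rightarrow> ennreal" where
  "quant_error N n r \<nu> =
     (INF A\<in>codebooks n.
        neg_powr (\<integral>\<^sup>+x. neg_powr (ennreal (dist_to N x A)) r \<partial>\<nu>) (1 / r))"

(* If the error is 0, the quotient below has denominator \<infinity> and hence value 0, which is the
   convention 1 / log 0 = 0. *)
definition quant_ratio ::
    "('a::euclidean_space \<Rightarrow> real) \<Rightarrow> real \<Rightarrow> 'a measure \<Rightarrow> nat \<Rightarrow> ereal" where
  "quant_ratio N r \<nu> n = ereal (ln (real n)) / (- elog (quant_error N n r \<nu>))"

lemma quant_ratio_error_zero: "quant_error N n r \<nu> = 0 \<Longrightarrow> quant_ratio N r \<nu> n = 0"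
  by (simp add: quant_ratio_def elog_def)

definition upper_quant_dim ::
    "('a::euclidean_space \<Rightarrow> real) \<Rightarrow> real \<Rightarrow> 'a measure \<Rightarrow> ereal" where
  "upper_quant_dim N r \<nu> = limsup (quant_ratio N r \<nu>)"

definition lower_quant_dim ::
    "('a::euclidean_space \<Rightarrow> real) \<Rightarrow> real \<Rightarrow> 'a measure \<Rightarrow> ereal" where
  "lower_quant_dim N r \<nu> = liminf (quant_ratio N r \<nu>)"

(* The quantization dimension exists and equals D. *)
definition has_quant_dim ::
    "('a::euclidean_space \<Rightarrow> real) \<Rightarrow> real \<Rightarrow> 'a measure \<Rightarrow> ereal \<Rightarrow> bool" where
  "has_quant_dim N r \<nu> D \<longleftrightarrow> upper_quant_dim N r \<nu> = D \<and> lower_quant_dim N r \<nu> = D"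

definition dim_infty :: "('a::euclidean_space \<Rightarrow> real) \<Rightarrow> 'a measure \<Rightarrow> ereal" where
  "dim_infty N \<nu> =
     Liminf (at_right 0) (\<lambda>s. (SUP x. elog (emeasure \<nu> (nball N x s))) / ereal (ln s))"

definition measure_supp :: "'a::topological_space measure \<Rightarrow> 'a set" where
  "measure_supp \<nu> = {x. \<forall>U. open U \<and> x \<in> U \<longrightarrow> emeasure \<nu> U > 0}"

definition lebesgue_decomposition ::
    "'a::euclidean_space measure \<Rightarrow> 'a measure \<Rightarrow> 'a measure \<Rightarrow> bool" where
  "lebesgue_decomposition \<nu> \<nu>a \<nu>s \<longleftrightarrow>
     sets \<nu>a = sets borel \<and> sets \<nu>s = sets borel \<and>
     (\<forall>A\<in>sets borel. emeasure \<nu> A = emeasure \<nu>a A + emeasure \<nu>s A) \<and>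
     absolutely_continuous lborel \<nu>a \<and>
     (\<exists>Z\<in>sets borel. emeasure lborel Z = 0 \<and> emeasure \<nu>s (- Z) = 0)"

definition has_nontrivial_ac_part :: "'a::euclidean_space measure \<Rightarrow> bool" where
  "has_nontrivial_ac_part \<nu> \<longleftrightarrow>
     (\<exists>\<nu>a \<nu>s. lebesgue_decomposition \<nu> \<nu>a \<nu>s \<and> emeasure \<nu>a UNIV \<noteq> 0)"

end

theory Submission
  imports Defs
begin

text \<open>
  Allowing more points only decreases the quantization error, so it suffices to look at one-point
  sets \<open>{a}\<close>. For these the integral is the potential
  \<open>F(a) = \<integral> N(x - a)\<^sup>r d\<nu>(x)\<close>, and since \<open>1/r < 0\<close> the error vanishes as soon as \<open>F\<close> is
  unbounded (lemma \<open>quant_error_eq_0_if_potential_unbounded\<close>). Both parts of the theorem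
  therefore ask for points with arbitrarily large potential.

  If \<open>- r > u > dim\<^sub>\<infinity>(\<nu>)\<close>, then for arbitrarily small \<open>s\<close> some ball of radius \<open>s\<close> has mass
  greater than \<open>s\<^sup>u\<close>. The potential at its centre is at least \<open>s\<^sup>r s\<^sup>u\<close>, which tends to
  infinity as \<open>s \<rightarrow> 0\<close> because \<open>r + u < 0\<close>.

  In the critical case \<open>r = - d\<close> the kernel \<open>N(z)\<^sup>r\<close> is not Lebesgue integrable near the
  origin. By Tonelli's theorem the Lebesgue integral of \<open>F\<close> over a large ball \<open>B\<close> equals the
  integral with respect to \<open>\<nu>\<close> of \<open>x \<mapsto> \<integral>\<^sub>B N(x - a)\<^sup>r da\<close>, and the inner integral is
  infinite for every \<open>x \<in> B\<close>. So \<open>F\<close> has infinite integral over a set of finite volume and cannot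
  be bounded.
\<close>

section \<open>Norms on Euclidean space\<close>

lemma is_norm_nonneg: "is_norm N \<Longrightarrow> 0 \<le> N x"
  and is_norm_eq_0_iff: "is_norm N \<Longrightarrow> N x = 0 \<longleftrightarrow> x = 0"
  and is_norm_scale: "is_norm N \<Longrightarrow> N (c *\<^sub>R x) = \<bar>c\<bar> * N x"
  and is_norm_triangle: "is_norm N \<Longrightarrow> N (x + y) \<le> N x + N y"
  by (auto simp: is_norm_def)

lemma is_norm_minus: "is_norm N \<Longrightarrow> N (- x) = N x"
  using is_norm_scale[of N "-1" x] by simp

lemma is_norm_diff_commute: "is_norm N \<Longrightarrow> N (x - y) = N (y - x)"
  using is_norm_minus[of N "x - y"] by simp

lemma is_norm_sum_le:
  assumes "is_norm N" "finite I"
  shows "N (\<Sum>i\<in>I. f i) \<le> (\<Sum>i\<in>I. N (f i))"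
  using assms(2)
proof (induction rule: finite_induct)
  case empty
  then show ?case using is_norm_eq_0_iff[OF assms(1), of 0] by simp
next
  case (insert i I)
  then show ?case
    using is_norm_triangle[OF assms(1), of "f i" "\<Sum>i\<in>I. f i"] by simp
qed

lemma is_norm_le_norm:
  fixes N :: "'a::euclidean_space \<Rightarrow> real"
  assumes "is_norm N"
  obtains M where "M > 0" "\<And>x. N x \<le> M * norm x"
proof -
  define M where "M = 1 + (\<Sum>b\<in>Basis. N b)"
  have "N x \<le> M * norm x" for x
  proof -
    have "N x = N (\<Sum>b\<in>Basis. (x \<bullet> b) *\<^sub>R b)"
      by (simp add: euclidean_representation)
    also have "\<dots> \<le> (\<Sum>b\<in>Basis. \<bar>x \<bullet> b\<bar> * N b)"
      using is_norm_sum_le[OF assms, of Basis "\<lambda>b. (x \<bullet> b) *\<^sub>R b"]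
      by (simp add: is_norm_scale[OF assms])
    also have "\<dots> \<le> (\<Sum>b\<in>Basis. norm x * N b)"
      by (intro sum_mono mult_right_mono is_norm_nonneg[OF assms]) (rule Basis_le_norm)
    also have "\<dots> \<le> M * norm x"
      by (simp add: M_def algebra_simps sum_distrib_left)
    finally show ?thesis .
  qed
  moreover have "M > 0"
    using sum_nonneg[of Basis N] is_norm_nonneg[OF assms] by (simp add: M_def add_pos_nonneg)
  ultimately show ?thesis using that by blast
qed

lemma is_norm_borel_measurable:
  fixes N :: "'a::euclidean_space \<Rightarrow> real"
  assumes "is_norm N"
  shows "N \<in> borel_measurable borel"
proof -
  obtain M where M: "M > 0" "\<And>x. N x \<le> M * norm x"
    using is_norm_le_norm[OF assms] by blast
  have "\<bar>N x - N y\<bar> \<le> M * norm (x - y)" for x y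
    using is_norm_triangle[OF assms, of "x - y" y] is_norm_triangle[OF assms, of "y - x" x]
      M(2)[of "x - y"] M(2)[of "y - x"] norm_minus_commute[of x y] by simp
  then have "M-lipschitz_on UNIV N"
    using M(1) by (intro lipschitz_onI) (auto simp: dist_norm)
  then have "continuous_on UNIV N"
    by (rule lipschitz_on_continuous_on)
  then show ?thesis
    by (rule borel_measurable_continuous_onI)
qed

section \<open>Negative powers\<close>

lemma neg_powr_ennreal:
  assumes "0 \<le> t"
  shows "neg_powr (ennreal t) r = (if t = 0 then \<infinity> else ennreal (t powr r))"
  using assms by (auto simp: neg_powr_def)

lemma ennreal_powr_le_neg_powr:
  assumes "0 \<le> t" "t \<le> b" "r \<le> 0"
  shows "ennreal (b powr r) \<le> neg_powr (ennreal t) r"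
  using assms by (auto simp: neg_powr_ennreal intro!: ennreal_leI powr_mono2')

lemma neg_powr_le_ennreal_powr:
  assumes "0 < b" "ennreal b \<le> y" "r \<le> 0"
  shows "neg_powr y r \<le> ennreal (b powr r)"
proof (cases y)
  case (real t)
  then have "b \<le> t" using assms by simp
  then show ?thesis
    using assms real by (auto simp: neg_powr_ennreal intro!: ennreal_leI powr_mono2')
next
  case top
  then show ?thesis by (simp add: neg_powr_def)
qed

lemma borel_measurable_neg_powr [measurable (raw)]:
  assumes [measurable]: "f \<in> borel_measurable M"
  shows "(\<lambda>x. neg_powr (f x) r) \<in> borel_measurable M"
  unfolding neg_powr_def by measurable

section \<open>Unbounded potentials and vanishing quantization error\<close>

definition potential ::
    "('a::euclidean_space \<Rightarrow> real) \<Rightarrow> real \<Rightarrow> 'a measure \<Rightarrow> 'a \<Rightarrow> ennreal" where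
  "potential N r \<nu> a = (\<integral>\<^sup>+x. neg_powr (ennreal (N (x - a))) r \<partial>\<nu>)"

lemma quant_error_le_potential:
  assumes "n \<ge> 1"
  shows "quant_error N n r \<nu> \<le> neg_powr (potential N r \<nu> a) (1 / r)"
proof -
  have "{a} \<in> codebooks n"
    using assms by (simp add: codebooks_def)
  then show ?thesis
    unfolding quant_error_def potential_def
    by (rule INF_lower2) (simp add: dist_to_def)
qed

lemma quant_error_eq_0_if_potential_unbounded:
  assumes "r < 0" "n \<ge> 1" "(SUP a. potential N r \<nu> a) = \<infinity>"
  shows "quant_error N n r \<nu> = 0"
proof -
  have "quant_error N n r \<nu> \<le> 0 + ennreal e" if "0 < e" for e
  proof -
    \<comment> \<open>A potential of at least \<open>e powr r\<close> is what makes the error at most \<open>e\<close>.\<close>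
    have "ennreal (e powr r) < (SUP a. potential N r \<nu> a)"
      unfolding assms(3) by simp
    then obtain a where "ennreal (e powr r) < potential N r \<nu> a"
      by (auto simp: less_SUP_iff)
    then have "neg_powr (potential N r \<nu> a) (1 / r) \<le> ennreal ((e powr r) powr (1 / r))"
      using assms(1) that by (intro neg_powr_le_ennreal_powr) auto
    also have "(e powr r) powr (1 / r) = e"
      using assms(1) that by (simp add: powr_powr)
    finally show ?thesis
      using quant_error_le_potential[OF assms(2), of N r \<nu> a] by simp
  qed
  then have "quant_error N n r \<nu> \<le> 0"
    by (rule ennreal_le_epsilon)
  then show ?thesis by simp
qed

lemma has_quant_dim_0_if_quant_error_eq_0:
  assumes "\<And>n. n \<ge> 1 \<Longrightarrow> quant_error N n r \<nu> = 0"
  shows "has_quant_dim N r \<nu> 0"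
proof -
  have "eventually (\<lambda>n. quant_ratio N r \<nu> n = 0) sequentially"
    using eventually_ge_at_top[of 1] by eventually_elim (simp add: assms quant_ratio_error_zero)
  then have "quant_ratio N r \<nu> \<longlonglongrightarrow> 0"
    by (rule tendsto_eventually)
  then show ?thesis
    unfolding has_quant_dim_def upper_quant_dim_def lower_quant_dim_def
    by (intro conjI lim_imp_Limsup lim_imp_Liminf) simp_all
qed

section \<open>Orders below the negative of the infinity-dimension\<close>

lemma elog_nonpos: "x \<le> 1 \<Longrightarrow> elog x \<le> 0"
  by (cases x) (auto simp: elog_def ln_le_zero_iff ennreal_le_1 top_unique)

lemma less_elogD:
  assumes "ereal c < elog y"
  shows "ennreal (exp c) \<le> y"
proof (cases y)
  case (real t)
  then show ?thesis
    using assms by (auto simp: elog_def split: if_splits intro!: ennreal_leI)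
      (metis exp_less_mono exp_ln less_eq_real_def)
qed simp

lemma dim_infty_nonneg:
  assumes "prob_space \<nu>"
  shows "0 \<le> dim_infty N \<nu>"
  unfolding dim_infty_def
proof (rule Liminf_bounded)
  have "eventually (\<lambda>s::real. s \<in> {0<..<1}) (at_right 0)"
    by (rule eventually_at_right_real) simp
  then show "\<forall>\<^sub>F s in at_right 0.
      0 \<le> (SUP x. elog (emeasure \<nu> (nball N x s))) / ereal (ln s)"
  proof eventually_elim
    case (elim s)
    have "(SUP x. elog (emeasure \<nu> (nball N x s))) \<le> 0"
      by (intro SUP_least elog_nonpos prob_space.emeasure_le_1[OF assms])
    moreover have "ln s < 0" using elim by simp
    ultimately show ?case
      by (cases "SUP x. elog (emeasure \<nu> (nball N x s))")
        (auto simp: divide_nonpos_neg)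
  qed
qed

text \<open>
  Since \<open>ln s < 0\<close>, a quotient below \<open>u\<close> in the definition of the dimension means that the
  supremum of the logarithmic masses exceeds \<open>u ln s\<close>. A lower limit below \<open>u\<close> only provides this
  for arbitrarily small radii, hence the frequency statement.
\<close>

lemma frequently_heavy_ball:
  assumes "dim_infty N \<nu> < ereal u"
  shows "frequently (\<lambda>s. \<exists>a. ennreal (s powr u) \<le> emeasure \<nu> (nball N a s)) (at_right 0)"
proof -
  let ?S = "\<lambda>s. SUP x. elog (emeasure \<nu> (nball N x s))"
  have "frequently (\<lambda>s. ?S s / ereal (ln s) < ereal u) (at_right 0)"
    using assms Liminf_bounded[of "ereal u" "\<lambda>s. ?S s / ereal (ln s)" "at_right 0"]
    unfolding dim_infty_def frequently_def not_less by auto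
  moreover have "eventually (\<lambda>s::real. s \<in> {0<..<1}) (at_right 0)"
    by (rule eventually_at_right_real) simp
  ultimately have "frequently (\<lambda>s. ?S s / ereal (ln s) < ereal u \<and> s \<in> {0<..<1}) (at_right 0)"
    by (rule frequently_eventually_frequently)
  then show ?thesis
  proof (rule frequently_elim1)
    fix s :: real
    assume s: "?S s / ereal (ln s) < ereal u \<and> s \<in> {0<..<1}"
    then have "ln s < 0" by simp
    then have "ereal (u * ln s) < ?S s"
      using s by (cases "?S s") (auto simp: neg_divide_less_eq)
    then obtain a where "ereal (u * ln s) < elog (emeasure \<nu> (nball N a s))"
      by (auto simp: less_SUP_iff)
    then have "ennreal (exp (u * ln s)) \<le> emeasure \<nu> (nball N a s)"
      by (rule less_elogD)
    then show "\<exists>a. ennreal (s powr u) \<le> emeasure \<nu> (nball N a s)"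
      using s by (auto simp: powr_def)
  qed
qed

lemma powr_times_nball_le_potential:
  assumes "is_norm N" "sets \<nu> = sets borel" "r \<le> 0"
  shows "ennreal (s powr r) * emeasure \<nu> (nball N a s) \<le> potential N r \<nu> a"
proof -
  note [measurable] = is_norm_borel_measurable[OF assms(1)]
  have "nball N a s \<in> sets borel"
    unfolding nball_def by measurable
  then have "ennreal (s powr r) * emeasure \<nu> (nball N a s)
      = (\<integral>\<^sup>+x. ennreal (s powr r) * indicator (nball N a s) x \<partial>\<nu>)"
    using assms(2) by (simp add: nn_integral_cmult_indicator)
  also have "\<dots> \<le> potential N r \<nu> a"
    unfolding potential_def
    by (intro nn_integral_mono)
      (auto simp: nball_def indicator_def is_norm_nonneg[OF assms(1)] assms(3)
        intro!: ennreal_powr_le_neg_powr)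
  finally show ?thesis .
qed

lemma potential_unbounded_below_dim_infty:
  assumes "is_norm N" "prob_space \<nu>" "sets \<nu> = sets borel" "ereal r < - dim_infty N \<nu>"
  shows "(SUP a. potential N r \<nu> a) = \<infinity>"
proof -
  have "dim_infty N \<nu> < ereal (- r)"
    using assms(4) by (cases "dim_infty N \<nu>") auto
  then obtain u where u: "dim_infty N \<nu> < ereal u" "u < - r"
    using ereal_dense2[of "dim_infty N \<nu>" "ereal (- r)"] by auto
  have "r < 0"
    using u dim_infty_nonneg[OF assms(2), of N] by (cases "dim_infty N \<nu>") auto
  have "ennreal C \<le> (SUP a. potential N r \<nu> a)" for C
  proof -
    have "eventually (\<lambda>s. s \<in> {0<..<max 1 C powr (1 / (r + u))}) (at_right 0)"
      by (rule eventually_at_right_real) simp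
    then have "eventually (\<lambda>s. C \<le> s powr (r + u)) (at_right 0)"
    proof eventually_elim
      case (elim s)
      have "max 1 C = (max 1 C powr (1 / (r + u))) powr (r + u)"
        using u(2) by (simp add: powr_powr)
      also have "\<dots> \<le> s powr (r + u)"
        using u(2) elim by (intro powr_mono2') auto
      finally show ?case by simp
    qed
    from frequently_ex[OF frequently_eventually_frequently[OF frequently_heavy_ball[OF u(1)] this]]
    obtain s a where s: "ennreal (s powr u) \<le> emeasure \<nu> (nball N a s)" "C \<le> s powr (r + u)"
      by blast
    have "ennreal C \<le> ennreal (s powr r) * ennreal (s powr u)"
      using s(2) by (simp add: powr_add ennreal_leI flip: ennreal_mult)
    also have "\<dots> \<le> ennreal (s powr r) * emeasure \<nu> (nball N a s)"
      using s(1) by (rule mult_left_mono) simp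
    also have "\<dots> \<le> potential N r \<nu> a"
      using \<open>r < 0\<close> by (intro powr_times_nball_le_potential[OF assms(1,3)]) simp
    also have "\<dots> \<le> (SUP a. potential N r \<nu> a)"
      by (rule SUP_upper) simp
    finally show ?thesis .
  qed
  then have "(SUP a. potential N r \<nu> a) \<noteq> ennreal B" if "B \<ge> 0" for B
    using that by (metis ennreal_le_iff less_add_one not_less)
  then show ?thesis
    by (cases "SUP a. potential N r \<nu> a") auto
qed

section \<open>The critical order\<close>

text \<open>
  In dimension \<open>d\<close> the volume of a ball of radius \<open>s\<close> scales like \<open>s\<^sup>d\<close>, while the kernel is at
  least a constant times \<open>s powr (- d)\<close> on that ball. So its integral over the ball is bounded below
  uniformly in \<open>s\<close>. If the integral were finite for one radius, it would have to shrink to the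
  integral over \<open>{0}\<close>, which is zero, as \<open>s\<close> tends to zero.
\<close>

lemma nn_integral_critical_kernel_ball:
  fixes N :: "'a::euclidean_space \<Rightarrow> real"
  assumes "is_norm N" "0 < e"
  shows "(\<integral>\<^sup>+z\<in>ball 0 e. neg_powr (ennreal (N z)) (- real DIM('a)) \<partial>lborel) = \<infinity>"
proof (rule ccontr)
  let ?k = "\<lambda>z. neg_powr (ennreal (N z)) (- real DIM('a))"
  note [measurable] = is_norm_borel_measurable[OF assms(1)]
  obtain M where M: "M > 0" "\<And>x. N x \<le> M * norm x"
    using is_norm_le_norm[OF assms(1)] by blast
  define c where "c = ennreal (M powr (- real DIM('a)) * unit_ball_vol (real DIM('a)))"
  define \<mu> where "\<mu> = density lborel ?k"
  define B where "B n = ball (0::'a) (e / Suc n)" for n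
  have \<mu>_ball: "emeasure \<mu> (ball 0 s) = (\<integral>\<^sup>+z\<in>ball 0 s. ?k z \<partial>lborel)" for s
    by (simp add: \<mu>_def emeasure_density)
  assume "(\<integral>\<^sup>+z\<in>ball 0 e. ?k z \<partial>lborel) \<noteq> \<infinity>"
  then have finite_e: "emeasure \<mu> (ball 0 e) \<noteq> \<infinity>"
    by (simp add: \<mu>_ball)
  have lower: "c \<le> emeasure \<mu> (ball 0 s)" if "s > 0" for s
  proof -
    have "(M * s) powr (- real DIM('a)) * s ^ DIM('a) = M powr (- real DIM('a))"
      using that M(1) by (simp add: powr_mult powr_minus powr_realpow field_simps)
    then have "c = ennreal ((M * s) powr (- real DIM('a))) * emeasure lborel (ball (0::'a) s)"
      using that by (simp add: c_def emeasure_ball mult_ac flip: ennreal_mult')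
    also have "\<dots> = (\<integral>\<^sup>+z. ennreal ((M * s) powr (- real DIM('a))) * indicator (ball 0 s) z
        \<partial>(lborel :: 'a measure))"
      by (simp add: nn_integral_cmult_indicator)
    also have "\<dots> \<le> (\<integral>\<^sup>+z\<in>ball 0 s. ?k z \<partial>lborel)"
    proof (intro nn_integral_mono)
      fix z :: 'a
      have "N z \<le> M * s" if "norm z < s"
        using order_trans[OF M(2)[of z] mult_left_mono[of "norm z" s M]] M(1) that by simp
      then show "ennreal ((M * s) powr (- real DIM('a))) * indicator (ball 0 s) z
          \<le> ?k z * indicator (ball 0 s) z"
        using ennreal_powr_le_neg_powr[of "N z" "M * s" "- real DIM('a)"]
          is_norm_nonneg[OF assms(1), of z]
        by (simp add: indicator_def)
    qed
    finally show ?thesis by (simp add: \<mu>_ball)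
  qed
  have "(INF n. emeasure \<mu> (B n)) = emeasure \<mu> (\<Inter>n. B n)"
  proof (rule INF_emeasure_decseq)
    show "range B \<subseteq> sets \<mu>"
      by (auto simp: B_def \<mu>_def)
    show "decseq B"
      unfolding B_def
      by (intro decseq_SucI subset_ball divide_left_mono) (use assms(2) in auto)
    show "emeasure \<mu> (B n) \<noteq> \<infinity>" for n
    proof -
      have "B n \<subseteq> ball 0 e"
        unfolding B_def using assms(2) by (intro subset_ball) (simp add: field_simps)
      then have "emeasure \<mu> (B n) \<le> emeasure \<mu> (ball 0 e)"
        by (intro emeasure_mono) (auto simp: \<mu>_def)
      then show ?thesis using finite_e by (auto simp: top_unique)
    qed
  qed
  also have "(\<Inter>n. B n) = {0}"
  proof
    show "(\<Inter>n. B n) \<subseteq> {0}"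
    proof
      fix z assume z: "z \<in> (\<Inter>n. B n)"
      have "norm z \<le> e / Suc n" for n
        using z by (auto simp: B_def dist_norm less_imp_le)
      moreover have "(\<lambda>n. e / Suc n) \<longlonglongrightarrow> 0"
        by (rule LIMSEQ_Suc) (rule lim_const_over_n)
      ultimately have "norm z \<le> 0"
        by (intro LIMSEQ_le_const) auto
      then show "z \<in> {0}" by simp
    qed
  qed (use assms(2) in \<open>auto simp: B_def\<close>)
  also have "emeasure \<mu> {0} = 0"
  proof -
    have "{0::'a} \<in> null_sets lborel" by (simp add: finite_imp_null_set_lborel)
    moreover have "absolutely_continuous lborel \<mu>"
      unfolding \<mu>_def by (rule absolutely_continuousI_density) measurable
    ultimately show ?thesis
      by (auto simp: absolutely_continuous_def)
  qed
  finally have "(INF n. emeasure \<mu> (B n)) = 0" .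
  moreover have "c \<le> (INF n. emeasure \<mu> (B n))"
    using assms(2) by (intro INF_greatest) (simp add: B_def lower)
  moreover have "c > 0"
    using M(1) by (simp add: c_def)
  ultimately show False by simp
qed

text \<open>
  A bounded potential would have a finite Lebesgue integral over every ball \<open>D\<close>. Take \<open>D\<close> so large
  that \<open>\<nu>\<close> charges it. Exchanging the order of integration, each \<open>x \<in> D\<close> contributes the integral
  of the kernel over a neighbourhood of its singularity, which is infinite.
\<close>

lemma potential_unbounded_critical:
  fixes N :: "'a::euclidean_space \<Rightarrow> real"
  assumes "is_norm N" "finite_measure \<nu>" "sets \<nu> = sets borel" "emeasure \<nu> (space \<nu>) \<noteq> 0"
  shows "(SUP a. potential N (- real DIM('a)) \<nu> a) = \<infinity>"
proof (rule ccontr)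
  let ?k = "\<lambda>z. neg_powr (ennreal (N z)) (- real DIM('a))"
  let ?C = "SUP a. potential N (- real DIM('a)) \<nu> a"
  assume "?C \<noteq> \<infinity>"
  interpret finite_measure \<nu> by fact
  interpret pair_sigma_finite lborel \<nu> ..
  note [measurable] = is_norm_borel_measurable[OF assms(1)]
  note [measurable_cong] = assms(3)
  have "\<exists>n. emeasure \<nu> (ball 0 (real n)) \<noteq> 0"
  proof (rule ccontr)
    assume "\<nexists>n. emeasure \<nu> (ball 0 (real n)) \<noteq> 0"
    then have "emeasure \<nu> (\<Union>n. ball 0 (real n)) = 0"
      by (intro emeasure_UN_eq_0) (auto simp: assms(3))
    moreover have "(\<Union>n. ball 0 (real n)) = space \<nu>"
      using sets_eq_imp_space_eq[OF assms(3)] reals_Archimedean2 by auto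
    ultimately show False using assms(4) by simp
  qed
  then obtain n where n: "emeasure \<nu> (ball 0 (real n)) \<noteq> 0" by blast
  define D where "D = ball (0::'a) (real n)"
  have D [measurable]: "D \<in> sets borel" by (simp add: D_def)
  have inner: "(\<integral>\<^sup>+a\<in>D. ?k (x - a) \<partial>lborel) = \<infinity>" if "x \<in> D" for x
  proof -
    obtain e where e: "e > 0" "ball x e \<subseteq> D"
      using \<open>x \<in> D\<close> openE[OF open_ball, of x 0 "real n"] unfolding D_def by metis
    have [measurable]: "ball (0::'a) e \<in> sets borel" by simp
    have "\<infinity> = (\<integral>\<^sup>+z\<in>ball 0 e. ?k z \<partial>lborel)"
      using nn_integral_critical_kernel_ball[OF assms(1) e(1)] by simp
    also have "\<dots> = (\<integral>\<^sup>+z. ?k z * indicator (ball 0 e) z \<partial>distr lborel borel ((+) (- x)))"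
      by (subst lborel_distr_plus) simp
    also have "\<dots> = (\<integral>\<^sup>+a. ?k (- x + a) * indicator (ball 0 e) (- x + a) \<partial>lborel)"
      by (subst nn_integral_distr) (simp_all, measurable)
    also have "\<dots> \<le> (\<integral>\<^sup>+a\<in>D. ?k (x - a) \<partial>lborel)"
    proof (intro nn_integral_mono)
      fix a :: 'a
      have "N (- x + a) = N (x - a)"
        using is_norm_diff_commute[OF assms(1), of a x] by simp
      moreover have "a \<in> D" if "- x + a \<in> ball 0 e"
        using that e(2) by (auto simp: dist_norm norm_minus_commute)
      ultimately show "?k (- x + a) * indicator (ball 0 e) (- x + a) \<le> ?k (x - a) * indicator D a"
        by (auto simp: indicator_def)
    qed
    finally show ?thesis by (simp add: top_unique)
  qed
  have "\<infinity> = (\<integral>\<^sup>+x. \<infinity> * indicator D x \<partial>\<nu>)"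
    using n by (subst nn_integral_cmult_indicator) (simp_all add: assms(3) D_def ennreal_top_mult)
  also have "\<dots> \<le> (\<integral>\<^sup>+x. (\<integral>\<^sup>+a\<in>D. ?k (x - a) \<partial>lborel) \<partial>\<nu>)"
    by (intro nn_integral_mono) (auto simp: inner split: split_indicator)
  also have "\<dots> = (\<integral>\<^sup>+a. (\<integral>\<^sup>+x. ?k (x - a) * indicator D a \<partial>\<nu>) \<partial>lborel)"
    by (rule Fubini'[of "\<lambda>a x. ?k (x - a) * indicator D a"]) measurable
  also have "\<dots> = (\<integral>\<^sup>+a\<in>D. potential N (- real DIM('a)) \<nu> a \<partial>lborel)"
    unfolding potential_def by (intro nn_integral_cong nn_integral_multc) measurable
  also have "\<dots> \<le> (\<integral>\<^sup>+a. ?C * indicator D a \<partial>lborel)"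
    by (intro nn_integral_mono mult_right_mono SUP_upper) auto
  also have "\<dots> = ?C * emeasure lborel D"
    by (simp add: nn_integral_cmult_indicator)
  also have "\<dots> < \<infinity>"
  proof -
    have "?C < top"
      using \<open>?C \<noteq> \<infinity>\<close> by (simp only: infinity_ennreal_def less_top)
    then have "?C * emeasure lborel D < top"
      unfolding ennreal_mult_less_top
      using emeasure_lborel_ball_finite[of "0::'a" "real n"]
      by (simp only: D_def simp_thms infinity_ennreal_def)
    then show ?thesis by (simp only: infinity_ennreal_def)
  qed
  finally show False by simp
qed

section \<open>Vanishing of the quantization error\<close>

theorem proposition1p1:
  fixes N :: "'a::euclidean_space \<Rightarrow> real" and \<nu> :: "'a measure"
  assumes "is_norm N"
    and "prob_space \<nu>"
    and "sets \<nu> = sets borel"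
    and "compact (measure_supp \<nu>)"
  shows "(\<forall>r::real. ereal r < - dim_infty N \<nu> \<longrightarrow>
            (\<forall>n\<ge>1. quant_error N n r \<nu> = 0) \<and> has_quant_dim N r \<nu> 0) \<and>
         (has_nontrivial_ac_part \<nu> \<longrightarrow>
            (\<forall>n\<ge>1. quant_error N n (- real DIM('a)) \<nu> = 0))"
proof (intro conjI allI impI)
  fix r :: real
  assume r: "ereal r < - dim_infty N \<nu>"
  have "r < 0"
    using r dim_infty_nonneg[OF assms(2), of N] by (cases "dim_infty N \<nu>") auto
  have error_0: "quant_error N n r \<nu> = 0" if "n \<ge> 1" for n
    by (rule quant_error_eq_0_if_potential_unbounded[OF \<open>r < 0\<close> that
          potential_unbounded_below_dim_infty[OF assms(1-3) r]])
  then show "quant_error N n r \<nu> = 0" if "n \<ge> 1" for n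
    using that .
  show "has_quant_dim N r \<nu> 0"
    by (rule has_quant_dim_0_if_quant_error_eq_0) (rule error_0)
next
  fix n :: nat
  assume "n \<ge> 1"
  interpret prob_space \<nu> by fact
  have "(SUP a. potential N (- real DIM('a)) \<nu> a) = \<infinity>"
    by (rule potential_unbounded_critical[OF assms(1) finite_measure_axioms assms(3)])
      (simp add: emeasure_space_1)
  then show "quant_error N n (- real DIM('a)) \<nu> = 0"
    using \<open>n \<ge> 1\<close> by (intro quant_error_eq_0_if_potential_unbounded) auto
qed

end
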